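(* For every integer $n\ge 2$, $$\sum_{p\in T_{n,n-1}}\mathbf{x}^{\operatorname{Des}(p)}=\sum_{\pi\in\mathfrak{S}_n^*(321)}\mathbf{x}^{\operatorname{Des}(\pi)},$$ where $\mathbf{x}^J:=\prod_{j\in J}x_j$. Equivalently, $\mathcal{Q}(T_{n,n-1})=\mathcal{Q}(\mathfrak{S}_n^*(321))$.
   Context: $\overrightarrow{K}_n$ is the transitive tournament with vertex set $\{1,\dots,n\}$ and directed edges $(i,j)$, $i<j$. $T_{n,n-1}$ is the set of transitive $(n-1)$-partitions of $\overrightarrow{K}_n$: unordered partitions of the edge set into $n-1$ nonempty blocks such that every cycle of the underlying undirected graph contains two edges in the same block with opposite orientations with respect to a traversal of the cycle. For $p\in T_{n,n-1}$, $\operatorname{Des}(p):=\{i\in\{1,\dots,n-1\}: \text{the edge }(i,i+1)\text{ forms a singleton block in }p\}$. A permutation $\pi\in\mathfrak{S}_n$ is indecomposable if there is no $1\le r<n$ such that $\pi(i)<\pi(j)$ for all $i\le r<j$. $\mathfrak{S}_n^*(321)$ is the set of indecomposable permutations in $\mathfrak{S}_n$ with no decreasing subsequence of length 3. For $\pi\in\mathfrak{S}_n$, $\operatorname{Des}(\pi):=\{i: \pi(i)>\pi(i+1)\}$. For a finite set $A$ with a map $\operatorname{Des}:A\to 2^{\{1,\dots,n-1\}}$, $\mathcal{Q}(A):=\sum_{a\in A}\mathcal{F}_{\operatorname{Des}(a)}$, where $\mathcal{F}_J(\mathbf{x}):=\sum x_{i_1}\cdots x_{i_n}$ over $i_1\le\dots\le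 i_n$ with $i_j<i_{j+1}$ whenever $j\in J$. *)

theory Defs
  imports "HOL-Library.Disjoint_Sets" "HOL-Library.FuncSet" "HOL-Library.Poly_Mapping"
    "HOL-Combinatorics.Permutations"
begin

definition tournament_edges :: "nat \<Rightarrow> (nat \<times> nat) set" where
  "tournament_edges n = {(i, j). 1 \<le> i \<and> i < j \<and> j \<le> n}"

(* A cycle of the underlying undirected graph, given by its vertices in the order of a traversal;
   the k-th edge joins c ! k to its cyclic successor. E is meant to contain no loops and no
   antiparallel pairs, so cycles have length at least 3. *)
definition cyc_next :: "'a list \<Rightarrow> nat \<Rightarrow> 'a" where
  "cyc_next c k = c ! (Suc k mod length c)"

definition undirected_cycle :: "('a \<times> 'a) set \<Rightarrow> 'a list \<Rightarrow> bool" where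
  "undirected_cycle E c \<longleftrightarrow> 3 \<le> length c \<and> distinct c \<and>
     (\<forall>k < length c. (c ! k, cyc_next c k) \<in> E \<or> (cyc_next c k, c ! k) \<in> E)"

(* In the last condition the k-th edge is traversed along its orientation, the l-th against it. *)
definition transitive_partition :: "('a \<times> 'a) set \<Rightarrow> ('a \<times> 'a) set set \<Rightarrow> bool" where
  "transitive_partition E P \<longleftrightarrow> partition_on E P \<and>
     (\<forall>c. undirected_cycle E c \<longrightarrow>
        (\<exists>B \<in> P. \<exists>k < length c. \<exists>l < length c.
           (c ! k, cyc_next c k) \<in> B \<and> (cyc_next c l, c ! l) \<in> B))"

definition transitive_partitions :: "nat \<Rightarrow> nat \<Rightarrow> (nat \<times> nat) set set set" where
  "transitive_partitions n k = {P. transitive_partition (tournament_edges n) P \<and> card P = k}"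

definition Des_partition :: "nat \<Rightarrow> (nat \<times> nat) set set \<Rightarrow> nat set" where
  "Des_partition n P = {i \<in> {1..n - 1}. {(i, Suc i)} \<in> P}"

definition indecomposable :: "nat \<Rightarrow> (nat \<Rightarrow> nat) \<Rightarrow> bool" where
  "indecomposable n \<pi> \<longleftrightarrow>
     \<not> (\<exists>r. 1 \<le> r \<and> r < n \<and> (\<forall>i j. 1 \<le> i \<and> i \<le> r \<and> r < j \<and> j \<le> n \<longrightarrow> \<pi> i < \<pi> j))"

definition avoids_321 :: "nat \<Rightarrow> (nat \<Rightarrow> nat) \<Rightarrow> bool" where
  "avoids_321 n \<pi> \<longleftrightarrow>
     \<not> (\<exists>i j k. 1 \<le> i \<and> i < j \<and> j < k \<and> k \<le> n \<and> \<pi> i > \<pi> j \<and> \<pi> j > \<pi> k)"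

definition indecomposable_321_avoiding :: "nat \<Rightarrow> (nat \<Rightarrow> nat) set" where
  "indecomposable_321_avoiding n = {\<pi>. \<pi> permutes {1..n} \<and> indecomposable n \<pi> \<and> avoids_321 n \<pi>}"

definition Des_perm :: "nat \<Rightarrow> (nat \<Rightarrow> nat) \<Rightarrow> nat set" where
  "Des_perm n \<pi> = {i \<in> {1..n - 1}. \<pi> i > \<pi> (Suc i)}"

(* Integer polynomials in the variables x_j are finitely supported maps from exponent vectors
   to coefficients; this type carries the polynomial ring structure. *)
type_synonym exponents = "nat \<Rightarrow>\<^sub>0 nat"
type_synonym polynomial = "exponents \<Rightarrow>\<^sub>0 int"

definition var :: "nat \<Rightarrow> polynomial" where
  "var j = Poly_Mapping.single (Poly_Mapping.single j 1) 1"

definition set_monomial :: "nat set \<Rightarrow> polynomial" where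
  "set_monomial J = (\<Prod>j\<in>J. var j)"

(* Formal power series in x_1, x_2, ... are represented by their coefficient functions.
   The set below is finite, since every i_j must lie in the support of m. *)
type_synonym power_series = "exponents \<Rightarrow> int"

definition fundamental_qsym :: "nat \<Rightarrow> nat set \<Rightarrow> power_series" where
  "fundamental_qsym n J = (\<lambda>m. int (card {i \<in> {1..n} \<rightarrow>\<^sub>E {1..}.
      (\<forall>j \<in> {1..<n}. i j \<le> i (Suc j)) \<and>
      (\<forall>j \<in> {1..<n} \<inter> J. i j < i (Suc j)) \<and>
      (\<Sum>j = 1..n. Poly_Mapping.single (i j) 1) = m}))"

definition qsym_generating :: "nat \<Rightarrow> ('a \<Rightarrow> nat set) \<Rightarrow> 'a set \<Rightarrow> power_series" where
  "qsym_generating n Des A = (\<lambda>m. \<Sum>a\<in>A. fundamental_qsym n (Des a) m)"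

end

(* An indecomposable 321-avoiding permutation is determined by its running maximum M, a monotone map
   with M i > i for i < n; i is a descent iff M increases at i and is constant from i to i + 1.

   In a transitive partition an edge (i, k) with i < j < k shares its block with (i, j) or (j, k).
   Delete the last vertex n + 1 of a transitive partition of the tournament on n + 1 vertices into n
   blocks. Two blocks that contain only edges at n + 1 would violate the triangle condition, so, by
   the bound n - 1 on the number of remaining blocks, exactly one block is lost. It consists of the
   edges (x, n + 1) with m <= x <= n for some m, and every edge (x, n + 1) with x < m is in the block
   of (x, n). The admissible m form the left ends of the right spine of the binary tree
   behind the partition. A map M on n grows in the same way, by raising its values from m on for some
   m with M (m - 1) = m. The two recursions transform the set of admissible m and the descent set
   identically, so induction on n yields a descent-preserving bijection. *)

theory Submission
  imports Defs "HOL-Library.Infinite_Set"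
begin

section \<open>Staircases: the common model of both sides and its growth rule\<close>

section \<open>Staircases\<close>

text \<open>For \<open>n >= 2\<close> these turn out to be the running maxima of the permutations in
  question; \<open>i < M i\<close> expresses indecomposability. The value at \<open>0\<close> is
  that of an empty maximum, and the constant tail makes equality of functions equality of
  staircases.\<close>

definition staircases :: "nat \<Rightarrow> (nat \<Rightarrow> nat) set" where
  "staircases n = {M. mono M \<and> M 0 = 1 \<and> (\<forall>i<n. i < M i) \<and> (\<forall>i\<ge>n. M i = n)}"

text \<open>At a contact \<open>m\<close> the bound \<open>i < M i\<close> is tight for
  \<open>i = m - 1\<close>. These are the positions from which raising can be undone
  unambiguously.\<close>

definition contacts :: "nat \<Rightarrow> (nat \<Rightarrow> nat) \<Rightarrow> nat set" where
  "contacts n M = {m \<in> {1..n}. M (m - 1) = m}"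

definition Des_staircase :: "nat \<Rightarrow> (nat \<Rightarrow> nat) \<Rightarrow> nat set" where
  "Des_staircase n M = {i \<in> {1..n - 1}. M (i - 1) < M i \<and> M (Suc i) = M i}"

definition raise :: "(nat \<Rightarrow> nat) \<Rightarrow> nat \<Rightarrow> nat \<Rightarrow> nat" where
  "raise M m i = (if i < m then M i else Suc (M i))"

text \<open>The common effect of a growth step on both descent sets. For partitions,
  \<open>m = n\<close> means that the new star is the single edge \<open>(n, n + 1)\<close>, while
  the block of \<open>(n - 1, n)\<close> receives a second edge.\<close>

definition grow_Des :: "nat \<Rightarrow> nat \<Rightarrow> nat set \<Rightarrow> nat set" where
  "grow_Des n m D = (if m = n then insert n (D - {n - 1}) else D)"

lemma staircasesD:
  assumes "M \<in> staircases n"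
  shows "mono M" "M 0 = 1" "\<And>i. i < n \<Longrightarrow> i < M i" "\<And>i. i \<ge> n \<Longrightarrow> M i = n"
  using assms by (auto simp: staircases_def)

lemma raise_in_staircases:
  assumes "M \<in> staircases n" "m \<in> contacts n M"
  shows "raise M m \<in> staircases (Suc n)"
proof -
  note M = staircasesD[OF assms(1)]
  have m: "1 \<le> m" "m \<le> n" using assms(2) by (auto simp: contacts_def)
  have "mono (raise M m)"
    using M(1) by (force simp: mono_def raise_def intro: le_SucI)
  moreover have "i < raise M m i" if "i < Suc n" for i
    using M(3)[of i] M(4)[of i] that m by (cases "i < n") (auto simp: raise_def)
  ultimately show ?thesis
    using m M(2,4) by (auto simp: staircases_def raise_def)
qed

text \<open>Values before \<open>m\<close> do not change. A value at \<open>l - 1 >= m\<close> with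
  \<open>l <= n\<close> was at least \<open>l\<close> and is now larger, so no contact survives
  strictly between \<open>m\<close> and \<open>n + 1\<close>. The last index is always a
  contact.\<close>

lemma contacts_raise:
  assumes "M \<in> staircases n" "m \<in> contacts n M"
  shows "contacts (Suc n) (raise M m) = insert (Suc n) {l \<in> contacts n M. l \<le> m}"
proof -
  note M = staircasesD[OF assms(1)]
  have m: "1 \<le> m" "m \<le> n" using assms(2) by (auto simp: contacts_def)
  have "raise M m (l - 1) \<noteq> l" if "m < l" "l \<le> n" for l
    using M(3)[of "l - 1"] that by (cases l) (auto simp: raise_def)
  moreover have "raise M m (l - 1) = M (l - 1)" if "l \<le> m" "1 \<le> l" for l
    using that by (auto simp: raise_def)
  moreover have "raise M m n = Suc n" using m M(4) by (auto simp: raise_def)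
  ultimately have "l \<in> contacts (Suc n) (raise M m) \<longleftrightarrow> l \<in> insert (Suc n) {l \<in> contacts n M. l \<le> m}"
    for l
    using m by (cases "l = Suc n"; cases "m < l") (auto simp: contacts_def)
  then show ?thesis by blast
qed

text \<open>Raising changes one comparison, that of \<open>M (m - 1)\<close> with
  \<open>M m\<close>, which becomes strict. It was strict already if \<open>m < n\<close>, since
  then \<open>M m > m = M (m - 1)\<close>. For \<open>m = n\<close> the plateau from
  \<open>n - 1\<close> to \<open>n\<close> is broken, and a new increase at \<open>n\<close> is
  followed by a plateau.\<close>

lemma Des_staircase_raise:
  assumes "M \<in> staircases n" "m \<in> contacts n M"
  shows "Des_staircase (Suc n) (raise M m) = grow_Des n m (Des_staircase n M)"
proof -
  note M = staircasesD[OF assms(1)]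
  have m: "1 \<le> m" "m \<le> n" "M (m - 1) = m" using assms(2) by (auto simp: contacts_def)
  have mono: "M i \<le> M j" if "i \<le> j" for i j using M(1) that by (auto dest: monoD)
  have "i \<in> Des_staircase (Suc n) (raise M m) \<longleftrightarrow> i \<in> grow_Des n m (Des_staircase n M)" for i
  proof -
    consider "i = 0" | "n < i" | "1 \<le> i" "Suc i < m" | "1 \<le> i" "Suc i = m" | "i = m" "m < n"
      | "i = m" "m = n" | "m < i" "i < n" | "m < i" "i = n"
      using m by linarith
    then show ?thesis
    proof cases
      case 4
      then have "raise M m (Suc i) \<noteq> raise M m i" using mono[of i m] by (auto simp: raise_def)
      moreover have "M (Suc i) \<noteq> M i" if "m < n"
        using 4 m M(3)[OF that] by auto
      ultimately show ?thesis using 4 m by (cases "m = n") (auto simp: Des_staircase_def grow_Des_def)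
    next
      case 5
      then show ?thesis using m M(3)[of m] by (auto simp: Des_staircase_def grow_Des_def raise_def)
    next
      case 6
      then show ?thesis using m M(4) by (auto simp: Des_staircase_def grow_Des_def raise_def)
    next
      case 7
      then show ?thesis by (auto simp: Des_staircase_def grow_Des_def raise_def)
    next
      case 8
      then have "M (n - 1) = n" using M(3)[of "n - 1"] mono[of "n - 1" n] M(4)[of n] by force
      then show ?thesis using 8 m M(4) by (auto simp: Des_staircase_def grow_Des_def raise_def)
    qed (use m in \<open>auto simp: Des_staircase_def grow_Des_def raise_def\<close>)
  qed
  then show ?thesis by blast
qed

lemma bij_betw_raise:
  assumes "1 \<le> n"
  shows "bij_betw (\<lambda>(M, m). raise M m) (Sigma (staircases n) (contacts n)) (staircases (Suc n))"
proof (rule bij_betw_imageI)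
  show "inj_on (\<lambda>(M, m). raise M m) (Sigma (staircases n) (contacts n))"
  proof (rule inj_onI, clarsimp)
    fix M m N k
    assume *: "M \<in> staircases n" "m \<in> contacts n M" "N \<in> staircases n" "k \<in> contacts n N"
      and eq: "raise M m = raise N k"
    \<comment> \<open>Hence \<open>m\<close> can be read off as the largest contact of
      \<open>raise M m\<close> other than \<open>n + 1\<close>.\<close>
    have same: "insert (Suc n) {l \<in> contacts n M. l \<le> m} = insert (Suc n) {l \<in> contacts n N. l \<le> k}"
      using contacts_raise[OF *(1,2)] contacts_raise[OF *(3,4)] eq by simp
    have "m \<noteq> Suc n" "k \<noteq> Suc n" using *(2,4) by (auto simp: contacts_def)
    then have "m \<le> k" "k \<le> m"
      using equalityD1[OF same, THEN subsetD, of m] equalityD2[OF same, THEN subsetD, of k] *(2,4) by simp_all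
    moreover from this have "M i = N i" for i
      using fun_cong[OF eq, of i] by (auto simp: raise_def split: if_splits)
    ultimately show "M = N \<and> m = k" by auto
  qed
  show "(\<lambda>(M, m). raise M m) ` Sigma (staircases n) (contacts n) = staircases (Suc n)" (is "?L = ?R")
  proof
    show "?L \<subseteq> ?R" using raise_in_staircases by auto
    show "?R \<subseteq> ?L"
    proof
      fix N assume N: "N \<in> staircases (Suc n)"
      note S = staircasesD[OF N]
      have mono: "N i \<le> N j" if "i \<le> j" for i j using S(1) that by (auto dest: monoD)
      \<comment> \<open>The contact to lower from must be the largest one up to \<open>n\<close>:
        all values from there to \<open>n - 1\<close> then have slack at least 2, so subtracting 1
        preserves \<open>i < M i\<close>.\<close>
      define C where "C = {l \<in> {1..n}. N (l - 1) = l}"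
      define m where "m = Max C"
      have C: "finite C" "1 \<in> C" using S(2) assms by (auto simp: C_def)
      then have "m \<in> C" unfolding m_def by (intro Max_in) auto
      then have m: "1 \<le> m" "m \<le> n" "N (m - 1) = m" by (auto simp: C_def)
      have above: "Suc (Suc i) \<le> N i" if "m \<le> i" "i < n" for i
      proof -
        have "Suc i \<notin> C" using that Max_ge[OF C(1), of "Suc i"] unfolding m_def by linarith
        then show ?thesis using S(3)[of i] that by (auto simp: C_def)
      qed
      have top: "N i = Suc n" if "n \<le> i" for i
        using S(3)[of n] S(4)[of "Suc n"] S(4)[of i] mono[of n "Suc n"] that
        by (cases "i = n") auto
      define M where "M i = (if i < m then N i else N i - 1)" for i
      have pos: "0 < N i" for i using mono[of 0 i] S(2) by simp
      have Nm: "Suc m \<le> N m" using S(3)[of m] m by auto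
      have "mono M"
      proof (rule monoI)
        fix i j :: nat assume ij: "i \<le> j"
        show "M i \<le> M j"
        proof (cases "i < m \<and> m \<le> j")
          case True
          then have "N i \<le> m" "Suc m \<le> N j" using mono[of i "m - 1"] mono[of m j] m Nm by auto
          with True show ?thesis by (auto simp: M_def)
        next
          case False
          then show ?thesis using ij mono[OF ij] by (auto simp: M_def)
        qed
      qed
      moreover have "i < M i" if "i < n" for i
        using above[of i] S(3)[of i] that by (auto simp: M_def)
      moreover have "M i = n" if "n \<le> i" for i using top[OF that] that m by (auto simp: M_def)
      ultimately have "M \<in> staircases n" using S(2) m by (auto simp: staircases_def M_def)
      moreover have "m \<in> contacts n M" using m by (auto simp: contacts_def M_def)
      moreover have "N = raise M m" using Suc_pred[OF pos] by (auto simp: raise_def M_def fun_eq_iff)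
      ultimately show "N \<in> ?L" by force
    qed
  qed
qed

lemma staircases_1: "staircases 1 = {\<lambda>i. 1}"
proof -
  have "M = (\<lambda>i. 1)" if "M \<in> staircases 1" for M
  proof
    show "M i = 1" for i using staircasesD[OF that] by (cases i) auto
  qed
  then show ?thesis by (auto simp: staircases_def mono_def)
qed

section \<open>Reduction of the cycle condition to triangles\<close>

section \<open>Transitive partitions and triangles\<close>

definition triangle_condition :: "nat \<Rightarrow> (nat \<times> nat) set set \<Rightarrow> bool" where
  "triangle_condition n P \<longleftrightarrow> (\<forall>i j k. 1 \<le> i \<and> i < j \<and> j < k \<and> k \<le> n \<longrightarrow>
     (\<exists>B\<in>P. (i, k) \<in> B \<and> ((i, j) \<in> B \<or> (j, k) \<in> B)))"

lemma triangle_conditionD: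
  assumes "triangle_condition n P" "1 \<le> i" "i < j" "j < k" "k \<le> n"
  shows "\<exists>B\<in>P. (i, k) \<in> B \<and> ((i, j) \<in> B \<or> (j, k) \<in> B)"
  using assms unfolding triangle_condition_def by blast

text \<open>Traverse the triangle as \<open>i, j, k\<close>. Only the edge \<open>(i, k)\<close> is
  traversed against its orientation, so it is one of the two edges that the cycle condition
  provides.\<close>

lemma triangle_condition_if_transitive:
  assumes "transitive_partition (tournament_edges n) P"
  shows "triangle_condition n P"
  unfolding triangle_condition_def
proof (intro allI impI)
  fix i j k :: nat
  assume ijk: "1 \<le> i \<and> i < j \<and> j < k \<and> k \<le> n"
  have part: "partition_on (tournament_edges n) P" 
    using assms by (auto simp: transitive_partition_def)
  define c where "c = [i, j, k]"
  have nxt: "cyc_next c 0 = j" "cyc_next c 1 = k" "cyc_next c 2 = i"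
    and nth: "c ! 0 = i" "c ! 1 = j" "c ! 2 = k" and len: "length c = 3"
    by (simp_all add: c_def cyc_next_def)
  have less3: "x < 3 \<longleftrightarrow> x = 0 \<or> x = 1 \<or> x = 2" for x :: nat by auto
  have "undirected_cycle (tournament_edges n) c"
    unfolding undirected_cycle_def len less3
    using ijk nxt nth by (auto simp: c_def tournament_edges_def)
  then obtain B x y where B: "B \<in> P" "x < 3" "y < 3"
      "(c ! x, cyc_next c x) \<in> B" "(cyc_next c y, c ! y) \<in> B"
    using assms len unfolding transitive_partition_def by metis
  have fwd: "a < b" if "(a, b) \<in> B" for a b
    using that B(1) partition_onD1[OF part] by (auto simp: tournament_edges_def)
  have "x = 0 \<or> x = 1" "y = 2"
    using B(2-5) fwd[OF B(4)] fwd[OF B(5)] ijk nxt nth unfolding less3 by (auto dest: fwd)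
  then show "\<exists>B\<in>P. (i, k) \<in> B \<and> ((i, j) \<in> B \<or> (j, k) \<in> B)"
    using B nxt nth by auto
qed

text \<open>The arguments are two steps of a walk, not two edges: both run along their edges or both
  against them, within one block. Opposite directions are expressed by swapping the ends of one
  step.\<close>

definition same_direction :: "(nat \<times> nat) set set \<Rightarrow> nat \<Rightarrow> nat \<Rightarrow> nat \<Rightarrow> nat \<Rightarrow> bool" where
  "same_direction P u v u' v' \<longleftrightarrow>
     (\<exists>B\<in>P. (u, v) \<in> B \<and> (u', v') \<in> B \<or> (v, u) \<in> B \<and> (v', u') \<in> B)"

text \<open>The middle edge has only one orientation and lies in only one block, so the two
  witnessing blocks coincide and the directions match.\<close>

lemma same_direction_trans:
  assumes "partition_on E P" and "\<And>u v. (u, v) \<in> E \<Longrightarrow> (v, u) \<notin> E"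
    and "same_direction P a b c d" "same_direction P c d e f"
  shows "same_direction P a b e f"
proof -
  obtain B where B: "B \<in> P" "(a, b) \<in> B \<and> (c, d) \<in> B \<or> (b, a) \<in> B \<and> (d, c) \<in> B"
    using assms(3) by (auto simp: same_direction_def)
  obtain B' where B': "B' \<in> P" "(c, d) \<in> B' \<and> (e, f) \<in> B' \<or> (d, c) \<in> B' \<and> (f, e) \<in> B'"
    using assms(4) by (auto simp: same_direction_def)
  have E: "\<Union>P = E" "disjoint P" using assms(1) by (auto simp: partition_on_def)
  have not: "\<not> ((c, d) \<in> E \<and> (d, c) \<in> E)" using assms(2) by blast
  have "B \<subseteq> E" "B' \<subseteq> E" using B(1) B'(1) E(1) by auto
  then have both: "(c, d) \<in> B \<and> (c, d) \<in> B' \<or> (d, c) \<in> B \<and> (d, c) \<in> B'"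
    using B(2) B'(2) not by blast
  then have "B = B'"
    using E(2) B(1) B'(1) unfolding disjoint_def by blast
  then show ?thesis
    using B B' both \<open>B \<subseteq> E\<close> \<open>B' \<subseteq> E\<close> not unfolding same_direction_def by blast
qed

text \<open>In the closed walk \<open>a, b, c, a\<close> the edge joining the smallest and the
  largest vertex runs opposite to the other two, and it shares its block with one of them. The chord
  \<open>a, c\<close> is the closing step reversed, which turns opposition into agreement in the
  first two alternatives.\<close>

lemma triangle_directions:
  assumes "triangle_condition n P" and "{a, b, c} \<subseteq> {1..n}" and "distinct [a, b, c]"
  shows "same_direction P a c a b \<or> same_direction P a c b c \<or> same_direction P a b c b"
proof -
  note D = triangle_conditionD[OF assms(1)]
  have in_n: "1 \<le> a" "1 \<le> b" "1 \<le> c" "a \<le> n" "b \<le> n" "c \<le> n" using assms(2) by auto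
  consider "a < b" "b < c" | "a < c" "c < b" | "b < a" "a < c" | "b < c" "c < a"
    | "c < a" "a < b" | "c < b" "b < a"
    using assms(3) by fastforce
  then show ?thesis
  proof cases
    case 1 then show ?thesis using D[of a b c] in_n unfolding same_direction_def by blast
  next
    case 2 then show ?thesis using D[of a c b] in_n unfolding same_direction_def by blast
  next
    case 3 then show ?thesis using D[of b a c] in_n unfolding same_direction_def by blast
  next
    case 4 then show ?thesis using D[of b c a] in_n unfolding same_direction_def by blast
  next
    case 5 then show ?thesis using D[of c a b] in_n unfolding same_direction_def by blast
  next
    case 6 then show ?thesis using D[of c b a] in_n unfolding same_direction_def by blast
  qed
qed

text \<open>If no two edges of a path have opposite directions within one block, then its chord shares
  block and direction with an edge of the path; traversed backwards, the chord closes the cycle.\<close>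

lemma path_directions:
  assumes "triangle_condition n P" and part: "partition_on (tournament_edges n) P"
    and "set c \<subseteq> {1..n}" "distinct c" "Suc j < length c"
  shows "(\<exists>k l. k \<le> j \<and> l \<le> j \<and> same_direction P (c ! k) (c ! Suc k) (c ! Suc l) (c ! l)) \<or>
    (\<exists>k\<le>j. same_direction P (c ! 0) (c ! Suc j) (c ! k) (c ! Suc k))"
  using assms(5)
proof (induction j)
  case 0
  have "c ! 0 \<in> {1..n}" "c ! 1 \<in> {1..n}" "c ! 0 \<noteq> c ! 1"
    using subsetD[OF assms(3) nth_mem[OF Suc_lessD[OF 0]]] subsetD[OF assms(3) nth_mem[OF 0]]
      nth_eq_iff_index_eq[OF assms(4) Suc_lessD[OF 0] 0] by auto
  then have "(c ! 0, c ! 1) \<in> \<Union>P \<or> (c ! 1, c ! 0) \<in> \<Union>P"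
    unfolding partition_onD1[OF part, symmetric] by (auto simp: tournament_edges_def)
  then show ?case by (auto simp: same_direction_def)
next
  case (Suc j)
  consider (opp) "\<exists>k l. k \<le> j \<and> l \<le> j \<and> same_direction P (c ! k) (c ! Suc k) (c ! Suc l) (c ! l)"
    | (chord) k where "k \<le> j" "same_direction P (c ! 0) (c ! Suc j) (c ! k) (c ! Suc k)"
    using Suc by (meson Suc_lessD)
  then show ?case
  proof cases
    case opp
    then show ?thesis by (meson le_SucI)
  next
    case chord
    have antisym: "(v, u) \<notin> tournament_edges n" if "(u, v) \<in> tournament_edges n" for u v
      using that by (auto simp: tournament_edges_def)
    note trans = same_direction_trans[OF part antisym]
    let ?a = "c ! 0" and ?b = "c ! Suc j" and ?c = "c ! Suc (Suc j)"
    have "c ! k \<in> {1..n}" if "k \<le> Suc (Suc j)" for k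
      using subsetD[OF assms(3) nth_mem, of k] that Suc.prems by linarith
    then have "{?a, ?b, ?c} \<subseteq> {1..n}" by (simp del: atLeastAtMost_iff)
    moreover have "c ! k = c ! l \<longleftrightarrow> k = l" if "k \<le> Suc (Suc j)" "l \<le> Suc (Suc j)" for k l
      using nth_eq_iff_index_eq[OF assms(4), of k l] that Suc.prems by linarith
    then have "distinct [?a, ?b, ?c]" by simp
    \<comment> \<open>The triangle consists of the old chord, the new last edge and the new chord.
      The new chord agrees with the old one and hence with edge \<open>k\<close>, or it agrees with
      the last edge, or the last edge opposes the old chord and hence edge \<open>k\<close>.\<close>
    ultimately consider "same_direction P ?a ?c ?a ?b" | "same_direction P ?a ?c ?b ?c"
      | "same_direction P ?a ?b ?c ?b"
      using triangle_directions[OF assms(1)] by blast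
    then show ?thesis
    proof cases
      case 1
      then show ?thesis using trans[OF _ 1 chord(2)] chord(1) by (meson le_SucI)
    next
      case 2
      then show ?thesis by blast
    next
      case 3
      have "same_direction P (c ! k) (c ! Suc k) ?a ?b"
        using chord(2) by (auto simp: same_direction_def)
      from trans[OF _ this 3] chord(1) show ?thesis by (meson le_SucI order_refl)
    qed
  qed
qed

lemma transitive_if_triangle_condition:
  assumes tri: "triangle_condition n P" and part: "partition_on (tournament_edges n) P"
  shows "transitive_partition (tournament_edges n) P"
  unfolding transitive_partition_def
proof (intro conjI allI impI part)
  fix c assume cyc: "undirected_cycle (tournament_edges n) c"
  \<comment> \<open>Cut the cycle open at its last edge: the edges \<open>0\<close> to
    \<open>j\<close> form a path, and edge \<open>Suc j\<close> returns from its end to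
    \<open>c ! 0\<close>.\<close>
  define j where "j = length c - 2"
  have len: "length c = Suc (Suc j)" and dist: "distinct c"
    using cyc by (auto simp: j_def undirected_cycle_def)
  have nxt: "cyc_next c k = c ! Suc k" if "k \<le> j" for k
    using that len by (auto simp: cyc_next_def)
  have close: "cyc_next c (Suc j) = c ! 0" by (simp add: cyc_next_def len)
  have "c ! k \<in> {1..n}" if "k < length c" for k
    using cyc that by (auto simp: undirected_cycle_def tournament_edges_def)
  then have "set c \<subseteq> {1..n}" by (metis in_set_conv_nth subsetI)
  from path_directions[OF tri part this dist, of j] len
  consider (opp) k l where "k \<le> j" "l \<le> j" "same_direction P (c ! k) (c ! Suc k) (c ! Suc l) (c ! l)"
    | (chord) k where "k \<le> j" "same_direction P (c ! 0) (c ! Suc j) (c ! k) (c ! Suc k)"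
    by auto
  then show "\<exists>B\<in>P. \<exists>k<length c. \<exists>l<length c. (c ! k, cyc_next c k) \<in> B \<and> (cyc_next c l, c ! l) \<in> B"
  proof cases
    case opp
    then obtain B where "B \<in> P" "(c ! k, cyc_next c k) \<in> B \<and> (cyc_next c l, c ! l) \<in> B \<or>
        (c ! l, cyc_next c l) \<in> B \<and> (cyc_next c k, c ! k) \<in> B"
      by (auto simp: same_direction_def nxt)
    moreover have "k < length c" "l < length c" using opp len by auto
    ultimately show ?thesis by blast
  next
    case chord
    then obtain B where "B \<in> P" "(c ! k, cyc_next c k) \<in> B \<and> (cyc_next c (Suc j), c ! Suc j) \<in> B \<or>
        (c ! Suc j, cyc_next c (Suc j)) \<in> B \<and> (cyc_next c k, c ! k) \<in> B"
      by (auto simp: same_direction_def nxt close)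
    moreover have "k < length c" "Suc j < length c" using chord len by auto
    ultimately show ?thesis by blast
  qed
qed

lemma transitive_partition_tournament_iff:
  "transitive_partition (tournament_edges n) P \<longleftrightarrow>
     partition_on (tournament_edges n) P \<and> triangle_condition n P"
  using triangle_condition_if_transitive transitive_if_triangle_condition
  by (auto simp: transitive_partition_def)

section \<open>Adding a last vertex to a transitive partition\<close>

section \<open>Extending a transitive partition by a vertex\<close>

text \<open>From every vertex before \<open>m\<close>, the vertices \<open>m\<close> to
  \<open>n\<close> look alike: all edges to them lie in one block. This allows \<open>n + 1\<close>
  to join them as a further copy of \<open>n\<close>.\<close>

definition spine :: "nat \<Rightarrow> (nat \<times> nat) set set \<Rightarrow> nat set" where
  "spine n P = {m \<in> {1..n}. \<forall>x y. 1 \<le> x \<and> x < m \<and> m \<le> y \<and> y \<le> n \<longrightarrow>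
     (\<exists>B\<in>P. (x, y) \<in> B \<and> (x, n) \<in> B)}"

definition end_star :: "nat \<Rightarrow> nat \<Rightarrow> (nat \<times> nat) set" where
  "end_star n m = {(x, y). m \<le> x \<and> x \<le> n \<and> y = Suc n}"

definition extend_block :: "nat \<Rightarrow> nat \<Rightarrow> (nat \<times> nat) set \<Rightarrow> (nat \<times> nat) set" where
  "extend_block n m B = B \<union> {(x, y). x < m \<and> (x, n) \<in> B \<and> y = Suc n}"

definition extend_partition :: "nat \<Rightarrow> (nat \<times> nat) set set \<Rightarrow> nat \<Rightarrow> (nat \<times> nat) set set" where
  "extend_partition n P m = insert (end_star n m) (extend_block n m ` P)"

definition restrict_partition :: "nat \<Rightarrow> (nat \<times> nat) set set \<Rightarrow> (nat \<times> nat) set set" where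
  "restrict_partition n Q = (\<inter>) (tournament_edges n) ` Q - {{}}"

lemma tournament_edges_iff: "(x, y) \<in> tournament_edges n \<longleftrightarrow> 1 \<le> x \<and> x < y \<and> y \<le> n"
  by (simp add: tournament_edges_def)

lemma transitive_partitions_iff:
  "P \<in> transitive_partitions n k \<longleftrightarrow>
     partition_on (tournament_edges n) P \<and> triangle_condition n P \<and> card P = k"
  by (auto simp: transitive_partitions_def transitive_partition_tournament_iff)

lemma finite_tournament_edges: "finite (tournament_edges n)"
  by (rule finite_subset[of _ "{1..n} \<times> {1..n}"]) (auto simp: tournament_edges_def)

lemma partition_on_block_unique:
  assumes "partition_on E P" "B \<in> P" "C \<in> P" "e \<in> B" "e \<in> C"
  shows "B = C"
  using assms unfolding partition_on_def disjoint_def by blast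

context
  fixes n m :: nat and P :: "(nat \<times> nat) set set"
  assumes part: "partition_on (tournament_edges n) P" and tri: "triangle_condition n P"
    and m: "m \<in> spine n P"
begin

lemma spine_bounds: "1 \<le> m" "m \<le> n"
  using m by (auto simp: spine_def)

lemma block_bounds: "1 \<le> x \<and> x < y \<and> y \<le> n" if "B \<in> P" "(x, y) \<in> B"
proof -
  have "(x, y) \<in> tournament_edges n" unfolding partition_onD1[OF part] using that by blast
  then show ?thesis by (simp add: tournament_edges_iff)
qed

lemma obtain_block:
  assumes "1 \<le> x" "x < y" "y \<le> n"
  obtains B where "B \<in> P" "(x, y) \<in> B"
proof -
  have "(x, y) \<in> \<Union>P"
    unfolding partition_onD1[OF part, symmetric] using assms by (simp add: tournament_edges_iff)
  then show ?thesis using that by blast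
qed

lemma extend_block_old: "B \<in> P \<Longrightarrow> y \<le> n \<Longrightarrow> (x, y) \<in> extend_block n m B \<longleftrightarrow> (x, y) \<in> B"
  by (auto simp: extend_block_def)

lemma extend_block_new: "B \<in> P \<Longrightarrow> (x, Suc n) \<in> extend_block n m B \<longleftrightarrow> x < m \<and> (x, n) \<in> B"
  using block_bounds[of B x "Suc n"] by (auto simp: extend_block_def)

lemma extend_block_bounds:
  assumes "B \<in> P" "(x, y) \<in> extend_block n m B" shows "1 \<le> x \<and> x < y \<and> y \<le> Suc n"
proof (cases "(x, y) \<in> B")
  case True
  then show ?thesis using block_bounds[OF assms(1) True] by simp
next
  case False
  then have "(x, n) \<in> B" "y = Suc n" using assms(2) by (auto simp: extend_block_def)
  then show ?thesis using block_bounds[OF assms(1)] by fastforce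
qed

lemma extend_block_Int: "B \<in> P \<Longrightarrow> extend_block n m B \<inter> tournament_edges n = B"
  using block_bounds[of B] by (auto simp: extend_block_def tournament_edges_iff)

lemma inj_on_extend_block: "inj_on (extend_block n m) P"
  by (rule inj_on_inverseI[where g = "\<lambda>B. B \<inter> tournament_edges n"]) (rule extend_block_Int)

lemma block_nonempty: "B \<in> P \<Longrightarrow> B \<noteq> {}"
  using partition_onD3[OF part] by blast

lemma end_star_notin: "end_star n m \<notin> extend_block n m ` P"
proof
  assume "end_star n m \<in> extend_block n m ` P"
  then obtain B where B: "B \<in> P" "end_star n m = extend_block n m B" by blast
  obtain x y where "(x, y) \<in> B" using block_nonempty[OF B(1)] by auto
  with block_bounds[OF B(1) this] have "(x, y) \<in> end_star n m" "y \<le> n"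
    unfolding B(2) by (auto simp: extend_block_def)
  then show False by (auto simp: end_star_def)
qed

lemma partition_on_extend: "partition_on (tournament_edges (Suc n)) (extend_partition n P m)"
proof (rule partition_onI)
  show "\<Union> (extend_partition n P m) = tournament_edges (Suc n)"
  proof (rule set_eqI, rule iffI)
    fix e assume "e \<in> \<Union> (extend_partition n P m)"
    then consider "e \<in> end_star n m" | B where "B \<in> P" "e \<in> extend_block n m B"
      by (auto simp: extend_partition_def)
    then show "e \<in> tournament_edges (Suc n)"
    proof cases
      case 1
      then show ?thesis using spine_bounds by (auto simp: end_star_def tournament_edges_iff)
    next
      case 2
      then show ?thesis using extend_block_bounds by (cases e) (auto simp: tournament_edges_iff)
    qed
  next
    fix e assume "e \<in> tournament_edges (Suc n)"
    then obtain x y where e: "e = (x, y)" "1 \<le> x" "x < y" "y \<le> Suc n"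
      by (cases e) (auto simp: tournament_edges_iff)
    consider "y \<le> n" | "y = Suc n" "m \<le> x" | "y = Suc n" "x < m" using e by linarith
    then show "e \<in> \<Union> (extend_partition n P m)"
    proof cases
      case 1
      then obtain B where "B \<in> P" "(x, y) \<in> B" using obtain_block e by metis
      then show ?thesis using e by (auto simp: extend_partition_def extend_block_def)
    next
      case 2
      then show ?thesis using e by (auto simp: extend_partition_def end_star_def)
    next
      case 3
      then obtain B where "B \<in> P" "(x, n) \<in> B" using obtain_block[of x n] e spine_bounds by auto
      then show ?thesis using e 3 by (auto simp: extend_partition_def extend_block_def)
    qed
  qed
  have 1: "disjnt (extend_block n m B) (end_star n m)" if "B \<in> P" for B
    using that block_bounds[OF that] by (fastforce simp: disjnt_iff extend_block_def end_star_def)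
  have 2: "disjnt (extend_block n m B) (extend_block n m C)" if "B \<in> P" "C \<in> P" "B \<noteq> C" for B C
  proof -
    have neq: "e \<notin> B \<or> e \<notin> C" for e using partition_on_block_unique[OF part that(1,2)] that(3) by blast
    have "y \<le> n" if "(x, y) \<in> B \<union> C" for x y using block_bounds \<open>B \<in> P\<close> \<open>C \<in> P\<close> that by blast
    then show ?thesis using neq by (fastforce simp: disjnt_iff extend_block_def)
  qed
  show "disjnt p q" if "p \<in> extend_partition n P m" "q \<in> extend_partition n P m" "p \<noteq> q" for p q
    using that 1 2 unfolding extend_partition_def by (auto simp: disjnt_sym)
  have "(n, Suc n) \<in> end_star n m" using spine_bounds by (simp add: end_star_def)
  then show "{} \<notin> extend_partition n P m"
    using block_nonempty by (auto simp: extend_partition_def extend_block_def)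
qed

lemma card_extend: "card (extend_partition n P m) = Suc (card P)"
  using end_star_notin card_image[OF inj_on_extend_block]
    finite_elements[OF finite_tournament_edges part]
  by (simp add: extend_partition_def)

lemma extend_together:
  assumes "B \<in> P" "e \<in> extend_block n m B" "f \<in> extend_block n m B \<or> g \<in> extend_block n m B"
  shows "\<exists>B\<in>extend_partition n P m. e \<in> B \<and> (f \<in> B \<or> g \<in> B)"
  using assms by (auto simp: extend_partition_def)

lemma spineD:
  assumes "l \<in> spine n P" "1 \<le> x" "x < l" "l \<le> y" "y \<le> n"
  obtains B where "B \<in> P" "(x, y) \<in> B" "(x, n) \<in> B"
  using assms unfolding spine_def by blast

text \<open>Only triangles ending at \<open>n + 1\<close> are new. If \<open>m <= i\<close>, both
  edges at \<open>n + 1\<close> lie in the star. If \<open>i < m <= j\<close>, the spine puts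
  \<open>(i, j)\<close> into the block of \<open>(i, n)\<close>, which receives
  \<open>(i, n + 1)\<close>. If \<open>j < m\<close>, the triangle is a copy of
  \<open>i, j, n\<close>.\<close>

lemma triangle_condition_extend: "triangle_condition (Suc n) (extend_partition n P m)"
  unfolding triangle_condition_def
proof (intro allI impI, elim conjE)
  fix i j k assume ijk: "1 \<le> i" "i < j" "j < k" "k \<le> Suc n"
  consider "k \<le> n" | "k = Suc n" "m \<le> i" | "k = Suc n" "i < m" "m \<le> j" | "k = Suc n" "j < m"
    using ijk by linarith
  then show "\<exists>B\<in>extend_partition n P m. (i, k) \<in> B \<and> ((i, j) \<in> B \<or> (j, k) \<in> B)"
  proof cases
    case 1
    then obtain B where "B \<in> P" "(i, k) \<in> B" "(i, j) \<in> B \<or> (j, k) \<in> B"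
      using triangle_conditionD[OF tri ijk(1-3)] by blast
    then show ?thesis by (intro extend_together) (auto simp: extend_block_def)
  next
    case 2
    then show ?thesis using ijk by (auto simp: extend_partition_def end_star_def)
  next
    case 3
    then obtain B where "B \<in> P" "(i, j) \<in> B" "(i, n) \<in> B"
      using spineD[OF m ijk(1), of j] ijk by auto
    then show ?thesis using 3 by (intro extend_together) (auto simp: extend_block_def)
  next
    case 4
    then obtain B where "B \<in> P" "(i, n) \<in> B" "(i, j) \<in> B \<or> (j, n) \<in> B"
      using triangle_conditionD[OF tri ijk(1,2), of n] spine_bounds by auto
    then show ?thesis using 4 ijk by (intro extend_together) (auto simp: extend_block_def)
  qed
qed

text \<open>For \<open>l <= m\<close> the edges from \<open>x < l\<close> to \<open>n + 1\<close>
  copy those to \<open>n\<close>, so the condition persists. For \<open>m < l <= n\<close> it fails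
  at \<open>x = m\<close>, because \<open>(m, n + 1)\<close> lies in the star and
  \<open>(m, n)\<close> does not. This is the same rule as in \<open>contacts_raise\<close>.\<close>

lemma spine_extend:
  "spine (Suc n) (extend_partition n P m) = insert (Suc n) {l \<in> spine n P. l \<le> m}" (is "?L = ?R")
proof
  show "?R \<subseteq> ?L"
  proof
    fix l assume l: "l \<in> ?R"
    have "\<exists>B\<in>extend_partition n P m. (x, y) \<in> B \<and> (x, Suc n) \<in> B"
      if xy: "1 \<le> x" "x < l" "l \<le> y" "y \<le> Suc n" for x y
    proof (cases "l = Suc n")
      case True
      then have "(x, Suc n) \<in> \<Union> (extend_partition n P m)" "y = Suc n"
        unfolding partition_onD1[OF partition_on_extend, symmetric]
        using xy by (auto simp: tournament_edges_iff)
      then show ?thesis by blast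
    next
      case False
      then have l: "l \<in> spine n P" "l \<le> m" using l by auto
      \<comment> \<open>The minimum covers \<open>y = n + 1\<close>, where the edge to
        \<open>n\<close> is the one that is copied.\<close>
      obtain B where "B \<in> P" "(x, min y n) \<in> B" "(x, n) \<in> B"
        using spineD[OF l(1) xy(1,2), of "min y n"] l spine_bounds xy by auto
      then have "(x, y) \<in> extend_block n m B" "(x, Suc n) \<in> extend_block n m B"
        using xy l by (auto simp: extend_block_def min_def split: if_splits)
      then show ?thesis using \<open>B \<in> P\<close> by (auto simp: extend_partition_def)
    qed
    moreover have "l \<in> {1..Suc n}" using l by (auto simp: spine_def)
    ultimately show "l \<in> ?L" unfolding spine_def by blast
  qed
  show "?L \<subseteq> ?R"
  proof
    fix l assume l: "l \<in> ?L"
    show "l \<in> ?R"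
    proof (cases "l = Suc n")
      case False
      then have bounds: "1 \<le> l" "l \<le> n" using l by (auto simp: spine_def)
      have ex: "\<exists>B\<in>P. x < m \<and> (x, y) \<in> B \<and> (x, n) \<in> B" if xy: "1 \<le> x" "x < l" "l \<le> y" "y \<le> n" for x y
      proof -
        have "\<exists>C\<in>extend_partition n P m. (x, y) \<in> C \<and> (x, Suc n) \<in> C"
          using l xy unfolding spine_def by auto
        then obtain C where C: "C \<in> extend_partition n P m" "(x, y) \<in> C" "(x, Suc n) \<in> C" by blast
        then have "C \<noteq> end_star n m" using xy by (auto simp: end_star_def)
        then obtain B where B: "B \<in> P" "C = extend_block n m B" using C(1) by (auto simp: extend_partition_def)
        have "(x, y) \<in> B" using C(2) extend_block_old[OF B(1) xy(4)] unfolding B(2) by simp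
        moreover have "x < m \<and> (x, n) \<in> B" using C(3) extend_block_new[OF B(1)] unfolding B(2) by simp
        ultimately show ?thesis using B(1) by blast
      qed
      then have "l \<in> spine n P" using bounds unfolding spine_def by auto
      moreover have "l \<le> m"
      proof (rule ccontr)
        assume "\<not> l \<le> m"
        then show False using ex[of m n] spine_bounds bounds by auto
      qed
      ultimately show ?thesis by blast
    qed simp
  qed
qed

text \<open>The star is a singleton exactly for \<open>m = n\<close>. An old singleton
  \<open>{(i, i + 1)}\<close> gains an edge only if \<open>i + 1 = n\<close> and
  \<open>i < m\<close>, which again means \<open>m = n\<close>.\<close>

lemma Des_partition_extend:
  "Des_partition (Suc n) (extend_partition n P m) = grow_Des n m (Des_partition n P)"
proof -
  have star: "(n, Suc n) \<in> end_star n m" using spine_bounds by (simp add: end_star_def)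
  have "i \<in> Des_partition (Suc n) (extend_partition n P m) \<longleftrightarrow> i \<in> grow_Des n m (Des_partition n P)" for i
  proof -
    consider "i = 0 \<or> n < i" | "i = n" "1 \<le> i" | "1 \<le> i" "i < n" by linarith
    then show ?thesis
    proof cases
      case 1
      then show ?thesis using spine_bounds by (auto simp: Des_partition_def grow_Des_def)
    next
      case 2
      have "{(n, Suc n)} \<noteq> extend_block n m B" if "B \<in> P" for B
      proof
        assume "{(n, Suc n)} = extend_block n m B"
        then have "B = {(n, Suc n)} \<inter> tournament_edges n" using extend_block_Int[OF that] by simp
        then show False using block_nonempty[OF that] by (simp add: tournament_edges_iff)
      qed
      moreover have "{(n, Suc n)} = end_star n m \<longleftrightarrow> m = n"
      proof
        assume "{(n, Suc n)} = end_star n m"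
        moreover have "(m, Suc n) \<in> end_star n m" using spine_bounds by (simp add: end_star_def)
        ultimately show "m = n" by auto
      qed (auto simp: end_star_def)
      ultimately have "{(n, Suc n)} \<in> extend_partition n P m \<longleftrightarrow> m = n"
        unfolding extend_partition_def by blast
      then show ?thesis using 2 by (auto simp: Des_partition_def grow_Des_def)
    next
      case 3
      let ?e = "(i, Suc i)"
      have "{?e} = extend_block n m B \<longleftrightarrow> B = {?e} \<and> \<not> (Suc i = n \<and> m = n)" if "B \<in> P" for B
      proof
        assume eq: "{?e} = extend_block n m B"
        have "{?e} \<inter> tournament_edges n = B" unfolding eq by (rule extend_block_Int[OF that])
        then have "B = {?e}" using 3 by (auto simp: tournament_edges_iff)
        moreover have "(i, Suc n) \<notin> extend_block n m B" using 3 unfolding eq[symmetric] by simp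
        ultimately show "B = {?e} \<and> \<not> (Suc i = n \<and> m = n)"
          using 3 by (auto simp: extend_block_def)
      next
        assume "B = {?e} \<and> \<not> (Suc i = n \<and> m = n)"
        then show "{?e} = extend_block n m B"
          using spine_bounds by (auto simp: extend_block_def)
      qed
      moreover have "{?e} \<noteq> end_star n m"
      proof
        assume "{?e} = end_star n m"
        with star have "(n, Suc n) \<in> {?e}" by simp
        then show False using 3 by simp
      qed
      moreover have "{?e} \<in> extend_partition n P m \<longleftrightarrow>
          {?e} = end_star n m \<or> (\<exists>B\<in>P. {?e} = extend_block n m B)"
        by (auto simp: extend_partition_def)
      ultimately have "{?e} \<in> extend_partition n P m \<longleftrightarrow> {?e} \<in> P \<and> \<not> (Suc i = n \<and> m = n)"
        by simp
      then show ?thesis using 3 by (auto simp: Des_partition_def grow_Des_def)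
    qed
  qed
  then show ?thesis by blast
qed

lemma restrict_extend: "restrict_partition n (extend_partition n P m) = P"
proof -
  have "tournament_edges n \<inter> end_star n m = {}" by (auto simp: end_star_def tournament_edges_iff)
  moreover have "(\<inter>) (tournament_edges n) ` extend_block n m ` P = (\<lambda>B. B) ` P"
    unfolding image_image using extend_block_Int by (intro image_cong) (simp_all add: Int_commute)
  ultimately show ?thesis
    using partition_onD3[OF part] by (auto simp: restrict_partition_def extend_partition_def)
qed

end

text \<open>The star is recognisable as the block of \<open>(n, n + 1)\<close>, and \<open>m\<close>
  is its smallest left end. The old partition is recovered by restriction.\<close>

lemma inj_on_extend:
  assumes "partition_on (tournament_edges n) P" "triangle_condition n P" "m \<in> spine n P"
    and "partition_on (tournament_edges n) P'" "triangle_condition n P'" "m' \<in> spine n P'"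
    and eq: "extend_partition n P m = extend_partition n P' m'"
  shows "P = P' \<and> m = m'"
proof
  have mn: "m \<le> n" "m' \<le> n" using spine_bounds assms by blast+
  then have "(n, Suc n) \<in> end_star n m" "(n, Suc n) \<in> end_star n m'"
    by (simp_all add: end_star_def)
  moreover have "end_star n m \<in> extend_partition n P m"
    by (simp add: extend_partition_def)
  moreover have "end_star n m' \<in> extend_partition n P m"
    unfolding eq by (simp add: extend_partition_def)
  ultimately have "end_star n m = end_star n m'"
    using partition_on_block_unique[OF partition_on_extend[OF assms(1-3)]] by blast
  moreover have "(m, Suc n) \<in> end_star n m" "(m', Suc n) \<in> end_star n m'"
    using mn by (auto simp: end_star_def)
  ultimately have "(m, Suc n) \<in> end_star n m'" "(m', Suc n) \<in> end_star n m" by simp_all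
  then show "m = m'" by (simp add: end_star_def)
  show "P = P'" using restrict_extend[OF assms(1-3)] restrict_extend[OF assms(4-6)] eq by simp
qed

section \<open>Deleting the last vertex, and the bound on the number of blocks\<close>

lemma partition_on_restrict_partition:
  assumes "partition_on (tournament_edges (Suc n)) Q"
  shows "partition_on (tournament_edges n) (restrict_partition n Q)"
proof -
  have "tournament_edges n \<inter> tournament_edges (Suc n) = tournament_edges n"
    by (auto simp: tournament_edges_iff)
  then show ?thesis
    using partition_on_restrict[OF assms, of "tournament_edges n"] by (simp add: restrict_partition_def)
qed

lemma restrict_together:
  assumes "B \<in> Q" "e \<in> B" "e \<in> tournament_edges n"
  shows "tournament_edges n \<inter> B \<in> restrict_partition n Q"
  using assms by (auto simp: restrict_partition_def)

lemma triangle_condition_restrict: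
  assumes "triangle_condition (Suc n) Q"
  shows "triangle_condition n (restrict_partition n Q)"
  unfolding triangle_condition_def
proof (intro allI impI, elim conjE)
  fix i j k assume ijk: "1 \<le> i" "i < j" "j < k" "k \<le> n"
  obtain B where B: "B \<in> Q" "(i, k) \<in> B" "(i, j) \<in> B \<or> (j, k) \<in> B"
    using triangle_conditionD[OF assms ijk(1-3)] ijk by auto
  then have "tournament_edges n \<inter> B \<in> restrict_partition n Q"
    using ijk by (intro restrict_together[of _ _ "(i, k)"]) (auto simp: tournament_edges_iff)
  then show "\<exists>B\<in>restrict_partition n Q. (i, k) \<in> B \<and> ((i, j) \<in> B \<or> (j, k) \<in> B)"
    using B ijk by (intro bexI) (auto simp: tournament_edges_iff)
qed

lemma lost_block_edge:
  assumes "partition_on (tournament_edges (Suc n)) Q" "B \<in> Q" "B \<inter> tournament_edges n = {}"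
  obtains x where "(x, Suc n) \<in> B" "1 \<le> x" "x \<le> n"
proof -
  obtain x y where xy: "(x, y) \<in> B"
    using assms(1,2) by (metis ex_in_conv partition_onD3 surj_pair)
  then have "(x, y) \<in> tournament_edges (Suc n)" "(x, y) \<notin> tournament_edges n"
    using assms partition_onD1[OF assms(1)] by auto
  then have "y = Suc n" "1 \<le> x" "x \<le> n" by (auto simp: tournament_edges_iff)
  then show ?thesis using that xy by blast
qed

text \<open>Take edges \<open>(u, n + 1)\<close> and \<open>(v, n + 1)\<close> of lost blocks with
  \<open>u < v\<close>. The triangle \<open>u, v, n + 1\<close> joins \<open>(u, n + 1)\<close> to
  \<open>(u, v)\<close> or to \<open>(v, n + 1)\<close>; a lost block cannot contain
  \<open>(u, v)\<close>, so the two blocks are equal.\<close>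

lemma lost_block_unique:
  assumes part: "partition_on (tournament_edges (Suc n)) Q" and tri: "triangle_condition (Suc n) Q"
    and B: "B \<in> Q" "B \<inter> tournament_edges n = {}" and C: "C \<in> Q" "C \<inter> tournament_edges n = {}"
  shows "B = C"
proof -
  obtain x where x: "(x, Suc n) \<in> B" "1 \<le> x" "x \<le> n" using lost_block_edge[OF part B] by metis
  obtain y where y: "(y, Suc n) \<in> C" "1 \<le> y" "y \<le> n" using lost_block_edge[OF part C] by metis
  have aux: "B' = C'" if "B' \<in> Q" "C' \<in> Q" "B' \<inter> tournament_edges n = {}"
      "(u, Suc n) \<in> B'" "(v, Suc n) \<in> C'" "1 \<le> u" "v \<le> n" "u < v" for B' C' u v
  proof -
    obtain A where A: "A \<in> Q" "(u, Suc n) \<in> A" "(u, v) \<in> A \<or> (v, Suc n) \<in> A"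
      using triangle_conditionD[OF tri, of u v "Suc n"] \<open>1 \<le> u\<close> \<open>v \<le> n\<close> \<open>u < v\<close> by auto
    then have "A = B'" using partition_on_block_unique[OF part A(1) that(1)] that(4) by blast
    moreover have "(u, v) \<in> tournament_edges n" using that by (simp add: tournament_edges_iff)
    ultimately have "(v, Suc n) \<in> B'" using A(3) that(3) by blast
    then show ?thesis using partition_on_block_unique[OF part that(1,2)] that(5) by blast
  qed
  consider "x < y" | "x = y" | "y < x" by linarith
  then show ?thesis
  proof cases
    case 1
    then show ?thesis using aux[OF B(1) C(1) B(2) x(1) y(1) x(2) y(3)] by simp
  next
    case 2
    then show ?thesis using partition_on_block_unique[OF part B(1) C(1)] x y by blast
  next
    case 3
    then show ?thesis using aux[OF C(1) B(1) C(2) y(1) x(1) y(2) x(3)] by simp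
  qed
qed

text \<open>Blocks that keep an edge have distinct traces by disjointness, so the number drops
  exactly by the number of blocks that vanish.\<close>

lemma card_restrict_partition:
  assumes part: "partition_on (tournament_edges (Suc n)) Q"
  shows "card Q = card (restrict_partition n Q) + card {B \<in> Q. B \<inter> tournament_edges n = {}}"
proof -
  let ?S = "{B \<in> Q. B \<inter> tournament_edges n \<noteq> {}}" and ?L = "{B \<in> Q. B \<inter> tournament_edges n = {}}"
  have "finite Q" using finite_elements[OF finite_tournament_edges part] .
  then have "card Q = card ?S + card ?L"
    by (subst card_Un_disjoint[symmetric]) (auto intro: arg_cong[where f = card])
  moreover have "restrict_partition n Q = (\<inter>) (tournament_edges n) ` ?S"
    by (auto simp: restrict_partition_def)
  moreover have "inj_on ((\<inter>) (tournament_edges n)) ?S"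
    using partition_on_block_unique[OF part] by (intro inj_onI) blast
  ultimately show ?thesis by (simp add: card_image)
qed

lemma card_lost_blocks_le:
  assumes "partition_on (tournament_edges (Suc n)) Q" "triangle_condition (Suc n) Q"
  shows "card {B \<in> Q. B \<inter> tournament_edges n = {}} \<le> 1"
  using lost_block_unique[OF assms] finite_elements[OF finite_tournament_edges assms(1)]
  by (intro card_le_Suc0_iff_eq[THEN iffD2, folded One_nat_def]) auto

lemma card_transitive_partition_le:
  assumes "partition_on (tournament_edges n) Q" "triangle_condition n Q"
  shows "card Q \<le> n - 1"
  using assms
proof (induction n arbitrary: Q)
  case 0
  have "tournament_edges 0 = {}" by (auto simp: tournament_edges_def)
  then show ?case using 0 by (simp add: partition_on_empty)
next
  case (Suc n)
  show ?case
  proof (cases "n = 0")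
    \<comment> \<open>The first vertex is treated separately: with truncated subtraction the
      recursive bound would allow one block here instead of none.\<close>
    case True
    have "tournament_edges (Suc 0) = {}" by (auto simp: tournament_edges_def)
    then show ?thesis using Suc.prems True by (simp add: partition_on_empty)
  next
    case False
    have "card (restrict_partition n Q) \<le> n - 1"
      using Suc partition_on_restrict_partition triangle_condition_restrict by blast
    then show ?thesis
      using card_restrict_partition[OF Suc.prems(1)] card_lost_blocks_le[OF Suc.prems] False by linarith
  qed
qed

text \<open>The maximal number of blocks forces exactly one lost block \<open>C\<close>. With
  \<open>m\<close> its smallest left end, triangles with top \<open>n + 1\<close> show first that
  \<open>C\<close> is a full star and then that each remaining edge at \<open>n + 1\<close> lies
  with the edges from the same vertex to \<open>m, ..., n\<close>.\<close>

lemma extend_restrict: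
  assumes part: "partition_on (tournament_edges (Suc n)) Q" and tri: "triangle_condition (Suc n) Q"
    and card: "card Q = n" and n: "1 \<le> n"
  obtains m where "m \<in> spine n (restrict_partition n Q)"
    "Q = extend_partition n (restrict_partition n Q) m" "card (restrict_partition n Q) = n - 1"
proof -
  let ?R = "restrict_partition n Q" and ?E = "tournament_edges n"
  note partR = partition_on_restrict_partition[OF part]
  have "card ?R \<le> n - 1"
    using card_transitive_partition_le[OF partR triangle_condition_restrict[OF tri]] .
  then have cards: "card ?R = n - 1" "card {B \<in> Q. B \<inter> ?E = {}} = 1"
    using card_restrict_partition[OF part] card_lost_blocks_le[OF part tri] card n by linarith+
  then obtain C where C: "C \<in> Q" "C \<inter> ?E = {}" by (metis (mono_tags, lifting) card_1_singletonE insertI1 mem_Collect_eq)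
  note unique = partition_on_block_unique[OF part]
  have bounds: "1 \<le> x \<and> x < y \<and> y \<le> Suc n" if "B \<in> Q" "(x, y) \<in> B" for B x y
  proof -
    have "(x, y) \<in> tournament_edges (Suc n)" unfolding partition_onD1[OF part] using that by blast
    then show ?thesis by (simp add: tournament_edges_iff)
  qed
  have C_edges: "y = Suc n" if "(x, y) \<in> C" for x y
  proof (rule ccontr)
    assume "y \<noteq> Suc n"
    then have "(x, y) \<in> ?E" using bounds[OF C(1) that] by (simp add: tournament_edges_iff)
    then show False using that C(2) by blast
  qed
  define m where "m = (LEAST x. (x, Suc n) \<in> C)"
  obtain x0 where x0: "(x0, Suc n) \<in> C" using lost_block_edge[OF part C] by metis
  then have mC: "(m, Suc n) \<in> C" unfolding m_def by (rule LeastI)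
  then have m: "1 \<le> m" "m \<le> n" using bounds[OF C(1) mC] by auto
  have least: "m \<le> x" if "(x, Suc n) \<in> C" for x unfolding m_def using that by (rule Least_le)
  have in_C: "(y, Suc n) \<in> C" if "m \<le> y" "y \<le> n" for y
  proof (cases "m = y")
    case False
    then have "m < y" "y < Suc n" using that by simp_all
    then obtain A where A: "A \<in> Q" "(m, Suc n) \<in> A" "(m, y) \<in> A \<or> (y, Suc n) \<in> A"
      using triangle_conditionD[OF tri m(1), of y "Suc n"] by auto
    then have "A = C" using unique[OF A(1) C(1)] mC by blast
    then show ?thesis using A(3) C_edges[of m y] that by auto
  qed (use mC in simp)
  have C_eq: "C = end_star n m"
    using C_edges in_C least bounds[OF C(1)] by (fastforce simp: end_star_def)
  \<comment> \<open>The triangle \<open>x, y, n + 1\<close> leaves two choices;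
    \<open>(y, n + 1)\<close> is excluded because it lies in \<open>C\<close>, while
    \<open>(x, n + 1)\<close> does not, by minimality of \<open>m\<close>.\<close>
  have together: "\<exists>A\<in>Q. (x, Suc n) \<in> A \<and> (x, y) \<in> A" if xy: "1 \<le> x" "x < m" "m \<le> y" "y \<le> n" for x y
  proof -
    obtain A where A: "A \<in> Q" "(x, Suc n) \<in> A" "(x, y) \<in> A \<or> (y, Suc n) \<in> A"
      using triangle_conditionD[OF tri xy(1), of y "Suc n"] xy by auto
    have "(y, Suc n) \<notin> A"
      using unique[OF A(1) C(1), of "(y, Suc n)"] in_C[OF xy(3,4)] A(2) least[of x] xy(2) by auto
    then show ?thesis using A by blast
  qed
  have "m \<in> spine n ?R"
  proof -
    have "\<exists>B\<in>?R. (x, y) \<in> B \<and> (x, n) \<in> B" if xy: "1 \<le> x" "x < m" "m \<le> y" "y \<le> n" for x y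
    proof -
      obtain A where A: "A \<in> Q" "(x, Suc n) \<in> A" "(x, y) \<in> A" using together[OF xy] by blast
      obtain A' where A': "A' \<in> Q" "(x, Suc n) \<in> A'" "(x, n) \<in> A'" using together[of x n] xy m by auto
      have "A = A'" using unique[OF A(1) A'(1) A(2) A'(2)] .
      moreover have "(x, y) \<in> ?E" "(x, n) \<in> ?E" using xy by (auto simp: tournament_edges_iff)
      ultimately show ?thesis using restrict_together[OF A(1) A(3)] A A' by blast
    qed
    then show ?thesis using m unfolding spine_def by auto
  qed
  moreover have blocks: "extend_block n m (?E \<inter> B) = B" if B: "B \<in> Q" "B \<noteq> C" for B
  proof -
    have "(x, y) \<in> extend_block n m (?E \<inter> B) \<longleftrightarrow> (x, y) \<in> B" for x y
    proof (cases "y = Suc n")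
      case False
      then show ?thesis using bounds[OF B(1), of x y]
        by (auto simp: extend_block_def tournament_edges_iff)
    next
      case True
      have "(x, Suc n) \<in> B \<longleftrightarrow> x < m \<and> (x, n) \<in> ?E \<and> (x, n) \<in> B"
      proof (cases "1 \<le> x \<and> x < m")
        case True
        then obtain A where A: "A \<in> Q" "(x, Suc n) \<in> A" "(x, n) \<in> A" using together[of x n] m by auto
        then have "(x, Suc n) \<in> B \<longleftrightarrow> (x, n) \<in> B" using unique[OF A(1) B(1)] by blast
        then show ?thesis using True m by (auto simp: tournament_edges_iff)
      next
        case False
        have "(x, Suc n) \<notin> B"
        proof
          assume x: "(x, Suc n) \<in> B"
          then have "(x, Suc n) \<in> C" using False bounds[OF B(1) x] in_C by auto
          then show False using unique[OF B(1) C(1) x] B(2) by blast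
        qed
        then show ?thesis using False by (auto simp: tournament_edges_iff)
      qed
      then show ?thesis using True by (auto simp: extend_block_def tournament_edges_iff)
    qed
    then show ?thesis by auto
  qed
  have "?R = (\<inter>) ?E ` (Q - {C})"
  proof -
    have "?E \<inter> B \<noteq> {}" if "B \<in> Q - {C}" for B
      using lost_block_unique[OF part tri _ _ C] that by blast
    then show ?thesis using C by (auto simp: restrict_partition_def)
  qed
  then have "extend_block n m ` ?R = (\<lambda>B. B) ` (Q - {C})"
    using blocks by (simp add: image_image)
  then have "Q = extend_partition n ?R m" using C C_eq by (auto simp: extend_partition_def)
  ultimately show ?thesis using that cards by blast
qed

lemma bij_betw_extend:
  assumes "1 \<le> n"
  shows "bij_betw (\<lambda>(P, m). extend_partition n P m)
    (Sigma (transitive_partitions n (n - 1)) (spine n)) (transitive_partitions (Suc n) n)"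
proof (rule bij_betw_imageI)
  show "inj_on (\<lambda>(P, m). extend_partition n P m) (Sigma (transitive_partitions n (n - 1)) (spine n))"
    by (rule inj_onI) (auto simp: transitive_partitions_iff dest: inj_on_extend)
  show "(\<lambda>(P, m). extend_partition n P m) ` Sigma (transitive_partitions n (n - 1)) (spine n)
      = transitive_partitions (Suc n) n" (is "?L = ?R")
  proof
    show "?L \<subseteq> ?R"
      using partition_on_extend triangle_condition_extend card_extend assms
      by (auto simp: transitive_partitions_iff)
    show "?R \<subseteq> ?L"
    proof
      fix Q assume "Q \<in> ?R"
      then have Q: "partition_on (tournament_edges (Suc n)) Q" "triangle_condition (Suc n) Q" "card Q = n"
        by (auto simp: transitive_partitions_iff)
      obtain m where m: "m \<in> spine n (restrict_partition n Q)"
        "Q = extend_partition n (restrict_partition n Q) m" "card (restrict_partition n Q) = n - 1"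
        using extend_restrict[OF Q assms] .
      then have "restrict_partition n Q \<in> transitive_partitions n (n - 1)"
        using partition_on_restrict_partition[OF Q(1)] triangle_condition_restrict[OF Q(2)]
        by (simp add: transitive_partitions_iff)
      then show "Q \<in> ?L"
        using m by (intro image_eqI[of _ _ "(restrict_partition n Q, m)"]) auto
    qed
  qed
qed

section \<open>From permutations to staircases: injectivity and descents\<close>

section \<open>Running maxima of 321-avoiding permutations\<close>

text \<open>The inserted \<open>1\<close> supplies the value at position \<open>0\<close> and does
  not affect later values of a permutation of \<open>{1..n}\<close>. The minimum with
  \<open>n\<close> produces the constant tail of a staircase.\<close>

definition running_max :: "nat \<Rightarrow> (nat \<Rightarrow> nat) \<Rightarrow> nat \<Rightarrow> nat" where
  "running_max n \<pi> i = Max (insert 1 (\<pi> ` {1..min i n}))"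

lemma running_max_ge: "1 \<le> j \<Longrightarrow> j \<le> i \<Longrightarrow> j \<le> n \<Longrightarrow> \<pi> j \<le> running_max n \<pi> i"
  unfolding running_max_def by (rule Max_ge) auto

lemma running_max_cases:
  obtains "running_max n \<pi> i = 1"
  | j where "1 \<le> j" "j \<le> i" "j \<le> n" "running_max n \<pi> i = \<pi> j"
proof -
  have "running_max n \<pi> i \<in> insert 1 (\<pi> ` {1..min i n})"
    unfolding running_max_def by (rule Max_in) auto
  then show ?thesis using that by auto
qed

lemma running_max_le:
  assumes "1 \<le> k" "\<And>j. 1 \<le> j \<Longrightarrow> j \<le> i \<Longrightarrow> j \<le> n \<Longrightarrow> \<pi> j \<le> k"
  shows "running_max n \<pi> i \<le> k"
  using assms by (cases rule: running_max_cases[of n \<pi> i]) auto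

lemma mono_running_max: "mono (running_max n \<pi>)"
  unfolding running_max_def by (intro monoI Max_mono insert_mono image_mono) auto

lemma running_max_Suc:
  assumes "i < n" shows "running_max n \<pi> (Suc i) = max (running_max n \<pi> i) (\<pi> (Suc i))"
proof -
  have "{1..min (Suc i) n} = insert (Suc i) {1..min i n}" using assms by auto
  then have "insert 1 (\<pi> ` {1..min (Suc i) n}) = insert (\<pi> (Suc i)) (insert 1 (\<pi> ` {1..min i n}))"
    by (simp add: insert_commute)
  then show ?thesis
    unfolding running_max_def by (simp only:) (subst Max_insert, auto simp: max.commute)
qed

lemma avoids_321D:
  assumes "avoids_321 n \<pi>" "1 \<le> i" "i < j" "j < k" "k \<le> n" "\<pi> j < \<pi> i" "\<pi> k < \<pi> j"
  shows False
  using assms unfolding avoids_321_def by blast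

lemma permutes_bounds: "\<pi> permutes {1..n} \<Longrightarrow> 1 \<le> i \<Longrightarrow> i \<le> n \<Longrightarrow> 1 \<le> \<pi> i \<and> \<pi> i \<le> n"
  for \<pi> :: "nat \<Rightarrow> nat"
  using permutes_in_image[of \<pi> "{1..n}" i] by simp

lemma permutes_eq_iff: "\<pi> permutes S \<Longrightarrow> \<pi> i = \<pi> j \<longleftrightarrow> i = j"
  using permutes_inj[of \<pi> S] by (auto dest: injD)

text \<open>If the maximum of the first \<open>i < n\<close> values were at most \<open>i\<close>,
  these values would fill \<open>{1..i}\<close>, and the permutation would decompose at
  \<open>i\<close>.\<close>

lemma running_max_in_staircases:
  assumes perm: "\<pi> permutes {1..n}" and indec: "indecomposable n \<pi>" and n: "1 \<le> n"
  shows "running_max n \<pi> \<in> staircases n"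
proof -
  have "i < running_max n \<pi> i" if "i < n" for i
  proof (rule ccontr)
    assume "\<not> i < running_max n \<pi> i"
    then have le: "\<pi> j \<le> i" if "1 \<le> j" "j \<le> i" for j
      using running_max_ge[of j i n \<pi>] that \<open>i < n\<close> by linarith
    have "1 \<le> running_max n \<pi> i" unfolding running_max_def by simp
    then have i: "1 \<le> i" using \<open>\<not> i < running_max n \<pi> i\<close> by simp
    have "\<pi> ` {1..i} \<subseteq> {1..i}" using le permutes_bounds[OF perm] \<open>i < n\<close> by fastforce
    then have img: "\<pi> ` {1..i} = {1..i}"
      using permutes_inj[OF perm] by (intro endo_inj_surj) (auto intro: inj_on_subset)
    have "\<pi> k < \<pi> j" if "1 \<le> k" "k \<le> i" "i < j" "j \<le> n" for j k
    proof -
      have "\<pi> j \<notin> \<pi> ` {1..i}"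
        using that permutes_eq_iff[OF perm] by auto
      then have "\<pi> j \<notin> {1..i}" unfolding img .
      then show ?thesis using permutes_bounds[OF perm, of j] le[of k] that by auto
    qed
    then show False using indec i \<open>i < n\<close> unfolding indecomposable_def by blast
  qed
  moreover have "running_max n \<pi> i = n" if "n \<le> i" for i
  proof (rule antisym)
    show "running_max n \<pi> i \<le> n" using n permutes_bounds[OF perm] by (intro running_max_le) auto
    have "n \<in> \<pi> ` {1..n}" using permutes_image[OF perm] n by auto
    then show "n \<le> running_max n \<pi> i" using running_max_ge[of _ i n \<pi>] that by fastforce
  qed
  moreover have "running_max n \<pi> 0 = 1" by (simp add: running_max_def)
  ultimately show ?thesis using mono_running_max by (simp add: staircases_def)
qed

text \<open>Suppose \<open>\<pi> i < \<sigma> i\<close> at the first difference. The value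
  \<open>\<pi> i\<close> occurs in \<open>\<sigma>\<close> at some \<open>k > i\<close>. The common
  running maximum is at least \<open>\<sigma> i\<close>, so it is attained by \<open>\<pi>\<close>
  at some \<open>j < i\<close>, where \<open>\<sigma>\<close> agrees. Then \<open>j, i, k\<close>
  form a 321 in \<open>\<sigma>\<close>.\<close>

lemma running_max_determines:
  assumes perm: "\<pi> permutes {1..n}" "\<sigma> permutes {1..n}" and avoids: "avoids_321 n \<sigma>"
    and same: "running_max n \<pi> = running_max n \<sigma>"
    and below: "\<And>j. j < i \<Longrightarrow> \<pi> j = \<sigma> j" and i: "1 \<le> i" "i \<le> n"
  shows "\<sigma> i \<le> \<pi> i"
proof (rule ccontr)
  assume "\<not> \<sigma> i \<le> \<pi> i"
  then have less: "\<pi> i < \<sigma> i" by simp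
  note bounds = permutes_bounds[OF perm(1) i]
  have "\<pi> i \<in> \<sigma> ` {1..n}" using bounds permutes_image[OF perm(2)] by auto
  then obtain k where k: "1 \<le> k" "k \<le> n" "\<sigma> k = \<pi> i" by force
  have "i < k"
    using below[of k] k less permutes_eq_iff[OF perm(1), of k i] by (cases k i rule: linorder_cases) auto
  have "\<sigma> i \<le> running_max n \<pi> i" using running_max_ge[OF i(1) _ i(2)] same by simp
  then obtain j where j: "1 \<le> j" "j \<le> i" "\<sigma> i \<le> \<pi> j"
    using bounds less by (cases rule: running_max_cases[of n \<pi> i]) auto
  then have "j < i" using less by (cases "j = i") auto
  then have "\<sigma> i < \<sigma> j"
    using below[of j] j permutes_eq_iff[OF perm(2), of i j] by (simp add: le_less)
  then show False
    using avoids_321D[OF avoids j(1) \<open>j < i\<close> \<open>i < k\<close> k(2)] k(3) less by simp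
qed

lemma inj_on_running_max: "inj_on (running_max n) (indecomposable_321_avoiding n)"
proof (rule inj_onI)
  fix \<pi> \<sigma> assume A: "\<pi> \<in> indecomposable_321_avoiding n" "\<sigma> \<in> indecomposable_321_avoiding n"
    and same: "running_max n \<pi> = running_max n \<sigma>"
  then have perm: "\<pi> permutes {1..n}" "\<sigma> permutes {1..n}"
    and avoids: "avoids_321 n \<pi>" "avoids_321 n \<sigma>"
    by (auto simp: indecomposable_321_avoiding_def)
  have "\<pi> i = \<sigma> i" for i
  proof (induction i rule: less_induct)
    case (less i)
    show ?case
    proof (cases "1 \<le> i \<and> i \<le> n")
      case True
      then show ?thesis
        using running_max_determines[OF perm avoids(2) same less]
          running_max_determines[OF perm(2,1) avoids(1) same[symmetric] less[symmetric]]
        by (intro antisym) auto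
    next
      case False
      then show ?thesis using perm by (auto simp: permutes_def)
    qed
  qed
  then show "\<pi> = \<sigma>" by auto
qed

text \<open>The top of a descent is a new maximum, since a larger earlier value would complete a 321
  with it and its successor. Conversely, an increase at \<open>i\<close> gives
  \<open>\<pi> i = M i\<close>, and a plateau after it keeps the next value below.\<close>

lemma Des_perm_eq_Des_staircase:
  assumes "\<pi> \<in> indecomposable_321_avoiding n"
  shows "Des_perm n \<pi> = Des_staircase n (running_max n \<pi>)"
proof -
  have perm: "\<pi> permutes {1..n}" and indec: "indecomposable n \<pi>" and avoids: "avoids_321 n \<pi>"
    using assms by (auto simp: indecomposable_321_avoiding_def)
  let ?M = "running_max n \<pi>"
  have "\<pi> (Suc i) < \<pi> i \<longleftrightarrow> ?M (i - 1) < ?M i \<and> ?M (Suc i) = ?M i" if i: "1 \<le> i" "i < n" for i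
  proof -
    have Mi: "?M i = max (?M (i - 1)) (\<pi> i)" using running_max_Suc[of "i - 1" n \<pi>] i by simp
    have MSuc: "?M (Suc i) = max (?M i) (\<pi> (Suc i))" using running_max_Suc[OF i(2)] .
    have large: "i < ?M i"
      using staircasesD(3)[OF running_max_in_staircases[OF perm indec], of i] i by simp
    have neq: "\<pi> (Suc i) \<noteq> \<pi> i" using permutes_eq_iff[OF perm, of "Suc i" i] by simp
    show ?thesis
    proof
      assume desc: "\<pi> (Suc i) < \<pi> i"
      have "?M (i - 1) < \<pi> i"
      proof (rule ccontr)
        assume "\<not> ?M (i - 1) < \<pi> i"
        then have le: "\<pi> i \<le> ?M (i - 1)" by simp
        show False
        proof (cases rule: running_max_cases[of n \<pi> "i - 1"])
          case 1
          then show False using Mi large le i by simp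
        next
          case (2 j)
          have "j < i" using 2(2) i by linarith
          moreover have "\<pi> i \<noteq> \<pi> j" using permutes_eq_iff[OF perm, of i j] \<open>j < i\<close> by simp
          then have "\<pi> i < \<pi> j" using le 2(4) by simp
          ultimately show False using avoids_321D[OF avoids 2(1), of i "Suc i"] desc i by simp
        qed
      qed
      then show "?M (i - 1) < ?M i \<and> ?M (Suc i) = ?M i" using Mi MSuc desc by auto
    next
      assume "?M (i - 1) < ?M i \<and> ?M (Suc i) = ?M i"
      then show "\<pi> (Suc i) < \<pi> i" using Mi MSuc neq by auto
    qed
  qed
  then show ?thesis unfolding Des_perm_def Des_staircase_def by auto
qed

section \<open>From staircases back to permutations\<close>

lemma ex_order_isomorphism:
  fixes A B :: "nat set"
  assumes "finite A" "finite B" "card A = card B"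
  obtains f where "bij_betw f A B" "strict_mono_on A f"
proof -
  obtain a where a: "bij_betw a {..<card A} A" "strict_mono_on {..<card A} a"
    using ex_bij_betw_strict_mono_card[OF assms(1)] .
  obtain b where b: "bij_betw b {..<card A} B" "strict_mono_on {..<card A} b"
    using ex_bij_betw_strict_mono_card[OF assms(2)] assms(3) by metis
  let ?a' = "inv_into {..<card A} a"
  have a': "bij_betw ?a' A {..<card A}" using bij_betw_inv_into[OF a(1)] .
  have "strict_mono_on A (b \<circ> ?a')"
  proof (rule strict_mono_onI)
    fix x y assume xy: "x \<in> A" "y \<in> A" "x < y"
    have in_range: "?a' x \<in> {..<card A}" "?a' y \<in> {..<card A}"
      using bij_betwE[OF a'] xy by blast+
    have "a (?a' x) = x" "a (?a' y) = y" using bij_betw_inv_into_right[OF a(1)] xy by auto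
    then have "?a' x < ?a' y"
      using strict_mono_on_less[OF a(2) in_range] xy by simp
    then show "(b \<circ> ?a') x < (b \<circ> ?a') y"
      using strict_mono_on_less[OF b(2) in_range] by simp
  qed
  then show ?thesis using that bij_betw_trans[OF a' b(1)] by blast
qed

lemma staircase_is_running_max:
  assumes M: "M \<in> staircases n" and n: "2 \<le> n"
  obtains \<pi> where "\<pi> \<in> indecomposable_321_avoiding n" "running_max n \<pi> = M"
proof -
  txt \<open>The permutation takes the values of \<open>M\<close> at the positions where \<open>M\<close> increases and lists the
    remaining values in increasing order at the remaining positions.\<close>
  note S = staircasesD[OF M]
  have mono: "M i \<le> M j" if "i \<le> j" for i j using S(1) that by (auto dest: monoD)
  define E where "E = {i \<in> {1..n}. M (i - 1) < M i}"
  define N where "N = {1..n} - E"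
  define V where "V = M ` E"
  define W where "W = {1..n} - V"
  have E_mono: "M i < M j" if "i < j" "j \<in> E" for i j
  proof -
    have "i \<le> j - 1" using that(1) by simp
    from mono[OF this] show ?thesis using that(2) by (simp add: E_def)
  qed
  then have inj_E: "inj_on M E" by (intro linorder_inj_onI') fastforce+
  have M_pos: "1 \<le> M i" for i using mono[of 0 i] S(2) by simp
  have M_le: "M i \<le> n" if "i \<le> n" for i using mono[OF that] S(4)[of n] by simp
  have le_M: "i \<le> M i" if "i \<le> n" for i using S(3)[of i] S(4)[of n] that by (cases "i = n") auto
  have sub: "E \<subseteq> {1..n}" "V \<subseteq> {1..n}" using M_pos M_le by (auto simp: E_def V_def)
  have "card V = card E" unfolding V_def by (rule card_image[OF inj_E])
  then have "card N = card W"
    unfolding N_def W_def using sub by (simp add: card_Diff_subset finite_subset)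
  then obtain f where f: "bij_betw f N W" "strict_mono_on N f"
    using ex_order_isomorphism[of N W] by (auto simp: N_def W_def)
  define \<pi> where "\<pi> i = (if i \<in> E then M i else if i \<in> N then f i else i)" for i
  have "bij_betw \<pi> E V"
    using inj_E by (intro bij_betw_cong[THEN iffD1, OF _ inj_on_imp_bij_betw[OF inj_E, folded V_def]])
      (simp add: \<pi>_def)
  moreover have "bij_betw \<pi> N W"
    using f(1) by (rule bij_betw_cong[THEN iffD1, rotated]) (auto simp: \<pi>_def N_def)
  ultimately have "bij_betw \<pi> (E \<union> N) (V \<union> W)"
    by (rule bij_betw_combine) (auto simp: W_def)
  moreover have EN: "E \<union> N = {1..n}" and "V \<union> W = {1..n}" using sub by (auto simp: N_def W_def)
  ultimately have "bij_betw \<pi> {1..n} {1..n}" by simp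
  then have perm: "\<pi> permutes {1..n}"
    by (rule bij_imp_permutes) (use EN in \<open>auto simp: \<pi>_def\<close>)
  have \<pi>_N: "\<pi> i = f i" if "i \<in> N" for i using that by (auto simp: \<pi>_def N_def)
  txt \<open>Since \<open>i \<le> M i\<close>, at most as many values of \<open>V\<close> as positions of \<open>E\<close> are \<open>\<le> i\<close>, so the
    remaining values keep up with the remaining positions.\<close>
  have f_le: "f i \<le> i" if "i \<in> N" for i
  proof (rule ccontr)
    assume "\<not> f i \<le> i"
    then have less: "i < f i" by simp
    have i: "1 \<le> i" "i \<le> n" using that by (auto simp: N_def)
    \<comment> \<open>If \<open>f i > i\<close>, every value of \<open>W\<close> up to
      \<open>i\<close> is smaller than \<open>f i\<close> and thus sits at a position of
      \<open>N\<close> before \<open>i\<close>. Counting shows that there are too few such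
      positions.\<close>
    have "W \<inter> {1..i} \<subseteq> f ` (N \<inter> {1..<i})"
    proof
      fix w assume w: "w \<in> W \<inter> {1..i}"
      then obtain j where j: "j \<in> N" "w = f j" using bij_betw_imp_surj_on[OF f(1)] by auto
      then have "f j < f i" using w less by auto
      then have "j < i" using strict_mono_on_less[OF f(2) j(1) that] by simp
      then show "w \<in> f ` (N \<inter> {1..<i})" using j by (auto simp: N_def)
    qed
    then have "card (W \<inter> {1..i}) \<le> card (N \<inter> {1..<i})"
      by (meson card_image_le card_mono finite_Int finite_atLeastLessThan finite_imageI order_trans)
    also have "\<dots> < card (N \<inter> {1..i})"
      using that i by (intro psubset_card_mono) auto
    also have "\<dots> = i - card (E \<inter> {1..i})"
    proof -
      have "N \<inter> {1..i} = {1..i} - (E \<inter> {1..i})" using i by (auto simp: N_def)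
      then show ?thesis by (simp add: card_Diff_subset)
    qed
    also have "\<dots> \<le> i - card (V \<inter> {1..i})"
    proof -
      have "V \<inter> {1..i} \<subseteq> M ` (E \<inter> {1..i})"
        using le_M sub(1) by (fastforce simp: V_def)
      then have "card (V \<inter> {1..i}) \<le> card (E \<inter> {1..i})"
        by (meson card_image_le card_mono finite_Int finite_atLeastAtMost finite_imageI order_trans)
      then show ?thesis by simp
    qed
    also have "\<dots> = card (W \<inter> {1..i})"
    proof -
      have "W \<inter> {1..i} = {1..i} - (V \<inter> {1..i})" using i by (auto simp: W_def)
      then show ?thesis by (simp add: card_Diff_subset)
    qed
    finally show False by simp
  qed
  have \<pi>_le: "\<pi> j \<le> M j" if "1 \<le> j" "j \<le> n" for j
  proof (cases "j \<in> E")
    case False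
    then have "j \<in> N" using that by (simp add: N_def)
    then show ?thesis using f_le[of j] le_M[of j] that \<pi>_N by fastforce
  qed (simp add: \<pi>_def)
  have rm: "running_max n \<pi> i = M i" for i
  proof (rule antisym)
    show "running_max n \<pi> i \<le> M i"
      by (rule running_max_le[OF M_pos]) (rule order_trans[OF \<pi>_le mono])
    \<comment> \<open>The leftmost position of the plateau through \<open>i\<close>: either it is
      \<open>0\<close>, or \<open>M\<close> increases there and the permutation attains the value
      \<open>M i\<close>.\<close>
    define e where "e = (LEAST e. M e = M i)"
    have e: "M e = M i" unfolding e_def by (rule LeastI[of _ i]) simp
    have e_le: "e \<le> k" if "M k = M i" for k unfolding e_def using that by (rule Least_le)
    have "e \<le> i" using e_le by simp
    have "e \<le> n"
      using \<open>e \<le> i\<close> e_le[of n] S(4)[of n] S(4)[of i] by (cases "i \<le> n") auto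
    show "M i \<le> running_max n \<pi> i"
    proof (cases "e = 0")
      case True
      then have "M i = 1" using e S(2) by simp
      then show ?thesis by (simp add: running_max_def)
    next
      case False
      then have "M (e - 1) \<noteq> M e" using e_le[of "e - 1"] e by auto
      then have "M (e - 1) < M e" using mono[of "e - 1" e] by simp
      then have "e \<in> E" using False \<open>e \<le> n\<close> by (simp add: E_def)
      then have "\<pi> e = M i" using e by (simp add: \<pi>_def)
      then show ?thesis
        using running_max_ge[of e i n \<pi>] False \<open>e \<le> i\<close> \<open>e \<le> n\<close> by simp
    qed
  qed
  have "avoids_321 n \<pi>"
  proof -
    have incE: "\<pi> i < \<pi> j" if "i \<in> E" "j \<in> E" "i < j" for i j
      using E_mono that by (simp add: \<pi>_def)
    have incN: "\<pi> i < \<pi> j" if "i \<in> N" "j \<in> N" "i < j" for i j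
      using strict_mono_on_less[OF f(2) that(1,2)] that \<pi>_N by simp
    show ?thesis unfolding avoids_321_def
    proof (intro notI, elim exE conjE)
      fix i j k assume *: "1 \<le> i" "i < j" "j < k" "k \<le> n" "\<pi> j < \<pi> i" "\<pi> k < \<pi> j"
      then have "i \<in> E \<or> i \<in> N" "j \<in> E \<or> j \<in> N" "k \<in> E \<or> k \<in> N" by (auto simp: N_def)
      \<comment> \<open>Two of the three positions lie in the same class, \<open>E\<close> or
        \<open>N\<close>, and the permutation increases on each class.\<close>
      then show False
        using * incE[of i j] incE[of j k] incE[of i k] incN[of i j] incN[of j k] incN[of i k] by auto
    qed
  qed
  moreover have "indecomposable n \<pi>"
    unfolding indecomposable_def
  proof (intro notI, elim exE conjE)
    fix r assume r: "1 \<le> r" "r < n" and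
      dec: "\<forall>i j. 1 \<le> i \<and> i \<le> r \<and> r < j \<and> j \<le> n \<longrightarrow> \<pi> i < \<pi> j"
    \<comment> \<open>Decomposing at \<open>r\<close> would put all values after \<open>r\<close>
      above \<open>M r >= r + 1\<close>, so \<open>n - r\<close> values would have to fit into
      \<open>n - r - 1\<close> places. The default value \<open>1\<close> of the maximum is excluded
      by \<open>r < M r\<close>.\<close>
    obtain i where i: "1 \<le> i" "i \<le> r" "\<pi> i = M r"
      using S(3)[OF r(2)] r(1) rm[of r] by (cases rule: running_max_cases[of n \<pi> r]) auto
    have "\<pi> ` {Suc r..n} \<subseteq> {Suc (Suc r)..n}"
    proof
      fix y assume "y \<in> \<pi> ` {Suc r..n}"
      then obtain j where j: "y = \<pi> j" "r < j" "j \<le> n" by auto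
      have "\<pi> i < \<pi> j" using dec i j by blast
      then show "y \<in> {Suc (Suc r)..n}"
        using i(3) j S(3)[OF r(2)] permutes_bounds[OF perm, of j] by auto
    qed
    then have "card (\<pi> ` {Suc r..n}) \<le> card {Suc (Suc r)..n}" by (intro card_mono) auto
    moreover have "card (\<pi> ` {Suc r..n}) = card {Suc r..n}"
      using permutes_inj[OF perm] by (intro card_image) (auto intro: inj_on_subset)
    ultimately show False using r by simp
  qed
  ultimately show ?thesis
    using that[of \<pi>] perm rm by (auto simp: indecomposable_321_avoiding_def)
qed

lemma bij_betw_running_max:
  assumes "2 \<le> n"
  shows "bij_betw (running_max n) (indecomposable_321_avoiding n) (staircases n)"
proof (rule bij_betw_imageI[OF inj_on_running_max])
  show "running_max n ` indecomposable_321_avoiding n = staircases n"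
  proof
    show "running_max n ` indecomposable_321_avoiding n \<subseteq> staircases n"
      using running_max_in_staircases assms by (auto simp: indecomposable_321_avoiding_def)
    show "staircases n \<subseteq> running_max n ` indecomposable_321_avoiding n"
      using staircase_is_running_max[OF _ assms] by (metis image_eqI subsetI)
  qed
qed

section \<open>Matching the two growth rules\<close>

section \<open>The bijection\<close>

text \<open>One step of an isomorphism of generating trees: the children of \<open>a\<close> are
  labelled by \<open>L a\<close>, those of \<open>h a\<close> by \<open>K (h a)\<close>. As the
  label sets agree, children can be matched by label.\<close>

lemma lift_bijection:
  assumes h: "bij_betw h A B" and e: "bij_betw e (Sigma A L) A'" and f: "bij_betw f (Sigma B K) B'"
    and L: "\<forall>a\<in>A. L a = K (h a)"
  obtains h' where "bij_betw h' A' B'"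
    "\<And>a m. a \<in> A \<Longrightarrow> m \<in> L a \<Longrightarrow> h' (e (a, m)) = f (h a, m)"
proof -
  let ?g = "\<lambda>(a, m). (h a, m)"
  have "bij_betw ?g (Sigma A L) (Sigma B K)"
  proof (rule bij_betw_imageI)
    show "inj_on ?g (Sigma A L)"
      using bij_betw_imp_inj_on[OF h] by (auto simp: inj_on_def)
    show "?g ` Sigma A L = Sigma B K"
      using bij_betw_imp_surj_on[OF h] L by (fastforce simp: image_iff)
  qed
  then have "bij_betw (f \<circ> ?g \<circ> inv_into (Sigma A L) e) A' B'"
    using bij_betw_trans[OF bij_betw_inv_into[OF e] bij_betw_trans[OF _ f]] by (simp add: comp_assoc)
  moreover have "(f \<circ> ?g \<circ> inv_into (Sigma A L) e) (e (a, m)) = f (h a, m)"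
    if "a \<in> A" "m \<in> L a" for a m
    using bij_betw_inv_into_left[OF e, of "(a, m)"] that by simp
  ultimately show ?thesis using that by blast
qed

text \<open>Descent sets alone do not carry the induction; the equality of \<open>spine\<close> and
  \<open>contacts\<close> is kept as well, since it matches the children at the next step.\<close>

lemma Des_partition_bijection:
  assumes "1 \<le> n"
  obtains h where "bij_betw h (transitive_partitions n (n - 1)) (staircases n)"
    "\<And>P. P \<in> transitive_partitions n (n - 1) \<Longrightarrow>
       spine n P = contacts n (h P) \<and> Des_partition n P = Des_staircase n (h P)"
  using assms
proof (induction n arbitrary: thesis rule: dec_induct)
  case base
  have "tournament_edges 1 = {}" by (auto simp: tournament_edges_def)
  then have T: "transitive_partitions 1 0 = {{}}"
    by (auto simp: transitive_partitions_iff partition_on_empty triangle_condition_def)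
  show ?case
  proof (rule base)
    show "bij_betw (\<lambda>_ i. 1) (transitive_partitions 1 (1 - 1)) (staircases 1)"
      unfolding staircases_1 using T by (simp add: bij_betw_def)
    show "spine 1 P = contacts 1 (\<lambda>i. 1) \<and> Des_partition 1 P = Des_staircase 1 (\<lambda>i. 1)" for P
      by (auto simp: spine_def contacts_def Des_partition_def Des_staircase_def)
  qed
next
  case (step n)
  let ?T = "transitive_partitions n (n - 1)"
  obtain h where h: "bij_betw h ?T (staircases n)"
    "\<And>P. P \<in> ?T \<Longrightarrow> spine n P = contacts n (h P) \<and> Des_partition n P = Des_staircase n (h P)"
    using step.IH by blast
  have same: "\<forall>P\<in>?T. spine n P = contacts n (h P)" using h(2) by blast
  obtain h' where h': "bij_betw h' (transitive_partitions (Suc n) n) (staircases (Suc n))"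
    "\<And>P m. P \<in> ?T \<Longrightarrow> m \<in> spine n P \<Longrightarrow> h' (extend_partition n P m) = raise (h P) m"
    using lift_bijection[OF h(1) bij_betw_extend[OF step.hyps(1)] bij_betw_raise[OF step.hyps(1)], OF same]
    unfolding prod.case by blast
  have "spine (Suc n) Q = contacts (Suc n) (h' Q) \<and> Des_partition (Suc n) Q = Des_staircase (Suc n) (h' Q)"
    if "Q \<in> transitive_partitions (Suc n) n" for Q
  proof -
    have "Q \<in> (\<lambda>(P, m). extend_partition n P m) ` Sigma ?T (spine n)"
      unfolding bij_betw_imp_surj_on[OF bij_betw_extend[OF step.hyps(1)]] by (rule that)
    then obtain P m where Q: "P \<in> ?T" "m \<in> spine n P" "Q = extend_partition n P m"
      by auto
    have P: "partition_on (tournament_edges n) P" "triangle_condition n P"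
      using Q(1) by (auto simp: transitive_partitions_iff)
    have M: "h P \<in> staircases n" "m \<in> contacts n (h P)"
      using bij_betwE[OF h(1)] same Q by blast+
    show ?thesis
      using h'(2)[OF Q(1,2)] h(2)[OF Q(1)] spine_extend[OF P Q(2)] contacts_raise[OF M]
        Des_partition_extend[OF P Q(2)] Des_staircase_raise[OF M] by (simp add: Q(3))
  qed
  then show ?case using step.prems[of h'] h'(1) by simp
qed

theorem theorem4p16:
  fixes n :: nat
  assumes "n \<ge> 2"
  shows "(\<Sum>p\<in>transitive_partitions n (n - 1). set_monomial (Des_partition n p))
           = (\<Sum>\<pi>\<in>indecomposable_321_avoiding n. set_monomial (Des_perm n \<pi>))
       \<and> qsym_generating n (Des_partition n) (transitive_partitions n (n - 1))
           = qsym_generating n (Des_perm n) (indecomposable_321_avoiding n)"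
proof -
  let ?T = "transitive_partitions n (n - 1)" and ?A = "indecomposable_321_avoiding n"
  have "1 \<le> n" using assms by simp
  from Des_partition_bijection[OF this] obtain h where h: "bij_betw h ?T (staircases n)"
    "\<And>P. P \<in> ?T \<Longrightarrow> spine n P = contacts n (h P) \<and> Des_partition n P = Des_staircase n (h P)"
    by blast
  \<comment> \<open>With \<open>F\<close> arbitrary, one reindexing serves both the monomials and
    each coefficient of the quasisymmetric functions.\<close>
  have T: "(\<Sum>p\<in>?T. F (Des_partition n p)) = (\<Sum>M\<in>staircases n. F (Des_staircase n M))"
    for F :: "nat set \<Rightarrow> 'b::comm_monoid_add"
    using sum.reindex_bij_betw[OF h(1), of "\<lambda>M. F (Des_staircase n M)"] h(2) by simp
  have A: "(\<Sum>\<pi>\<in>?A. F (Des_perm n \<pi>)) = (\<Sum>M\<in>staircases n. F (Des_staircase n M))"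
    for F :: "nat set \<Rightarrow> 'b::comm_monoid_add"
    using sum.reindex_bij_betw[OF bij_betw_running_max[OF assms], of "\<lambda>M. F (Des_staircase n M)"]
      Des_perm_eq_Des_staircase by simp
  show ?thesis
    unfolding qsym_generating_def using T[of set_monomial] A[of set_monomial]
      T[of "\<lambda>J. fundamental_qsym n J m" for m] A[of "\<lambda>J. fundamental_qsym n J m" for m] by simp
qed

end
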